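(* Let $(\mathfrak g=\mathfrak g_{\bar 0}\oplus\mathfrak g_{\bar 1},B)$ be a $6$-dimensional complex odd-quadratic Lie superalgebra of weak filiform type. Then $\mathfrak g$ is isomorphic to either $\mathfrak g_6^0$ or $\mathfrak g_6^1$, where for $\delta\in\{0,1\}$ the Lie superalgebra $\mathfrak g_6^\delta$ is given in a suitable basis $\{X_1,X_2,X_3,e_3,u_2,v_2\}$, with $X_1,X_2,X_3$ even and $e_3,u_2,v_2$ odd, by the following non-zero bracket products $$[X_1,X_2]=X_3,\quad [X_1,e_3]=u_2,\quad [X_2,e_3]=v_2,\quad [e_3,e_3]=\delta X_3$$ (all of them skew-symmetric except $[e_3,e_3]$, which is symmetric). Moreover, in both cases $\mathfrak g_6^0$ and $\mathfrak g_6^1$, the only possible non-zero values of $B$ are determined by $$B(X_1,v_2)=\lambda,\quad B(X_1,e_3)=\alpha,\quad B(X_2,u_2)=-\lambda,\quad B(X_2,e_3)=\beta,\quad B(X_3,e_3)=\lambda,$$ with $\lambda\ne0$ and $\alpha,\beta\in\mathbb C$.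
   Context: A Lie superalgebra $\mathfrak g=\mathfrak g_{\bar 0}\oplus\mathfrak g_{\bar 1}$ is odd-quadratic, written $(\mathfrak g,B)$, if it carries a bilinear form $B$ with values in the ground field (here $\mathbb C$) that is supersymmetric ($B(X,Y)=(-1)^{ij}B(Y,X)$ for $X\in\mathfrak g_{\bar i},Y\in\mathfrak g_{\bar j}$), invariant ($B([X,Y],Z)=B(X,[Y,Z])$), odd ($B(\mathfrak g_{\bar 0},\mathfrak g_{\bar 0})=B(\mathfrak g_{\bar 1},\mathfrak g_{\bar 1})=0$) and non-degenerate; then $\dim\mathfrak g_{\bar 0}=\dim\mathfrak g_{\bar 1}$. A Lie superalgebra $\mathfrak g$ with $\dim\mathfrak g_{\bar 1}=m>0$ is of weak filiform type if there is a flag of subspaces $\mathfrak g_{\bar 1}=V_m\supset V_{m-1}\supset\dots\supset V_2\supset V_1=\{0\}$ with $\dim V_i=i$ and $[\mathfrak g_{\bar 0},V_i]=V_{i-1}$ for all $i\in\{2,\dots,m\}$, where $[\mathfrak g_{\bar 0},V_i]$ denotes the linear span of brackets (the flag jumps from dimension $2$ to dimension $0$). *)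

theory Defs
  imports "HOL-Analysis.Analysis" "HOL-Library.Z2"
begin

text \<open>
  The underlying vector space of a superalgebra is the whole type \<open>'a\<close>, with scalar multiplication
  \<open>scale\<close>. The homogeneous components are \<open>G 0\<close> (even) and \<open>G 1\<close> (odd), indexed by the two-element
  field \<open>bit\<close>, so that \<open>i + j\<close> and \<open>i * j\<close> are the sum and product of degrees modulo 2.
\<close>

definition super_sign :: "bit \<Rightarrow> bit \<Rightarrow> complex" where
  "super_sign i j = (if i * j = 1 then - 1 else 1)"

locale lie_superalgebra = vector_space scale
  for scale :: "complex \<Rightarrow> 'a::ab_group_add \<Rightarrow> 'a" +
  fixes G :: "bit \<Rightarrow> 'a set"
    and br :: "'a \<Rightarrow> 'a \<Rightarrow> 'a"
  assumes subspace_G: "subspace (G i)"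
    and G_inter: "G 0 \<inter> G 1 = {0}"
    and G_sum: "\<exists>x\<in>G 0. \<exists>y\<in>G 1. z = x + y"
    and br_linear_left: "Vector_Spaces.linear scale scale (\<lambda>x. br x y)"
    and br_linear_right: "Vector_Spaces.linear scale scale (br x)"
    and br_graded: "x \<in> G i \<Longrightarrow> y \<in> G j \<Longrightarrow> br x y \<in> G (i + j)"
    and br_super_skew: "x \<in> G i \<Longrightarrow> y \<in> G j \<Longrightarrow> br x y = - scale (super_sign i j) (br y x)"
    and br_super_jacobi: "x \<in> G i \<Longrightarrow> y \<in> G j \<Longrightarrow> z \<in> G k \<Longrightarrow>
      br x (br y z) = br (br x y) z + scale (super_sign i j) (br y (br x z))"

locale odd_quadratic_lie_superalgebra = lie_superalgebra scale G br
  for scale :: "complex \<Rightarrow> 'a::ab_group_add \<Rightarrow> 'a" and G and br +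
  fixes B :: "'a \<Rightarrow> 'a \<Rightarrow> complex"
  assumes B_linear_left: "Vector_Spaces.linear scale (*) (\<lambda>x. B x y)"
    and B_linear_right: "Vector_Spaces.linear scale (*) (B x)"
    and B_supersymmetric: "x \<in> G i \<Longrightarrow> y \<in> G j \<Longrightarrow> B x y = super_sign i j * B y x"
    and B_invariant: "B (br x y) z = B x (br y z)"
    and B_odd: "x \<in> G i \<Longrightarrow> y \<in> G i \<Longrightarrow> B x y = 0"
    and B_nondegenerate: "(\<And>y. B x y = 0) \<Longrightarrow> x = 0"

text \<open>
  The flag jumps from dimension 2 to dimension 0: \<open>V 1 = {0}\<close>, and \<open>dim (V i) = i\<close> is
  required for \<open>i \<ge> 2\<close> only. The library's \<open>dim\<close> is 0 on infinite-dimensional spaces, so \<open>m > 0\<close>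
  makes \<open>G 1\<close> finite-dimensional.
\<close>

definition (in lie_superalgebra) weak_filiform :: bool where
  "weak_filiform \<longleftrightarrow> (\<exists>m V. m = dim (G 1) \<and> m > 0 \<and>
     V m = G 1 \<and> V 1 = {0} \<and>
     (\<forall>i\<in>{2..m}. subspace (V i) \<and> dim (V i) = i \<and> V (i - 1) \<subset> V i \<and>
        span {br x v |x v. x \<in> G 0 \<and> v \<in> V i} = V (i - 1)))"

definition lie_superalgebra_iso ::
  "(complex \<Rightarrow> 'a::ab_group_add \<Rightarrow> 'a) \<Rightarrow> (bit \<Rightarrow> 'a set) \<Rightarrow> ('a \<Rightarrow> 'a \<Rightarrow> 'a) \<Rightarrow>
   (complex \<Rightarrow> 'b::ab_group_add \<Rightarrow> 'b) \<Rightarrow> (bit \<Rightarrow> 'b set) \<Rightarrow> ('b \<Rightarrow> 'b \<Rightarrow> 'b) \<Rightarrow>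
   ('a \<Rightarrow> 'b) \<Rightarrow> bool" where
  "lie_superalgebra_iso s G br s' G' br' f \<longleftrightarrow>
     Vector_Spaces.linear s s' f \<and> bij f \<and> (\<forall>i. f ` G i = G' i) \<and>
     (\<forall>x y. f (br x y) = br' (f x) (f y))"

text \<open>The algebras \<open>\<gg>\<^sub>6\<^sup>\<delta>\<close>, realised on the vector space with basis \<open>X1, X2, X3, e3, u2, v2\<close>.\<close>

datatype g6_index = X1 | X2 | X3 | e3 | u2 | v2

lemma UNIV_g6_index: "UNIV = {X1, X2, X3, e3, u2, v2}"
  using g6_index.exhaust by auto

instance g6_index :: finite
  by standard (simp add: UNIV_g6_index)

type_synonym g6 = "complex ^ g6_index"

fun g6_degree :: "g6_index \<Rightarrow> bit" where
  "g6_degree X1 = 0" | "g6_degree X2 = 0" | "g6_degree X3 = 0"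
| "g6_degree e3 = 1" | "g6_degree u2 = 1" | "g6_degree v2 = 1"

definition g6_basis :: "g6_index \<Rightarrow> g6" where
  "g6_basis a = axis a 1"

definition g6_part :: "bit \<Rightarrow> g6 set" where
  "g6_part i = vec.span {g6_basis a |a. g6_degree a = i}"

fun g6_product :: "complex \<Rightarrow> g6_index \<Rightarrow> g6_index \<Rightarrow> g6" where
  "g6_product \<delta> X1 X2 = g6_basis X3"
| "g6_product \<delta> X2 X1 = - g6_basis X3"
| "g6_product \<delta> X1 e3 = g6_basis u2"
| "g6_product \<delta> e3 X1 = - g6_basis u2"
| "g6_product \<delta> X2 e3 = g6_basis v2"
| "g6_product \<delta> e3 X2 = - g6_basis v2"
| "g6_product \<delta> e3 e3 = \<delta> *s g6_basis X3"
| "g6_product \<delta> _ _ = 0"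

definition g6_bracket :: "complex \<Rightarrow> g6 \<Rightarrow> g6 \<Rightarrow> g6" where
  "g6_bracket \<delta> x y = (\<Sum>a\<in>UNIV. \<Sum>b\<in>UNIV. (x $ a * y $ b) *s g6_product \<delta> a b)"

fun g6_form_value :: "complex \<Rightarrow> complex \<Rightarrow> complex \<Rightarrow> g6_index \<Rightarrow> g6_index \<Rightarrow> complex" where
  "g6_form_value l \<alpha> \<beta> X1 v2 = l"
| "g6_form_value l \<alpha> \<beta> v2 X1 = l"
| "g6_form_value l \<alpha> \<beta> X1 e3 = \<alpha>"
| "g6_form_value l \<alpha> \<beta> e3 X1 = \<alpha>"
| "g6_form_value l \<alpha> \<beta> X2 u2 = - l"
| "g6_form_value l \<alpha> \<beta> u2 X2 = - l"
| "g6_form_value l \<alpha> \<beta> X2 e3 = \<beta>"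
| "g6_form_value l \<alpha> \<beta> e3 X2 = \<beta>"
| "g6_form_value l \<alpha> \<beta> X3 e3 = l"
| "g6_form_value l \<alpha> \<beta> e3 X3 = l"
| "g6_form_value l \<alpha> \<beta> _ _ = 0"

lemma g6_sum_UNIV: "(\<Sum>a\<in>UNIV. f a) = f X1 + f X2 + f X3 + f e3 + f u2 + f v2"
  for f :: "g6_index \<Rightarrow> 'b::comm_monoid_add"
  by (simp add: UNIV_g6_index add.assoc)

lemma g6_all: "(\<forall>a. P a) \<longleftrightarrow> P X1 \<and> P X2 \<and> P X3 \<and> P e3 \<and> P u2 \<and> P v2"
  by (metis g6_index.exhaust)

lemma g6_part_iff: "x \<in> g6_part i \<longleftrightarrow> (\<forall>a. g6_degree a \<noteq> i \<longrightarrow> x $ a = 0)"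
proof
  assume "x \<in> g6_part i"
  then show "\<forall>a. g6_degree a \<noteq> i \<longrightarrow> x $ a = 0"
    unfolding g6_part_def
    by (induction rule: vec.span_induct_alt) (auto simp: g6_basis_def axis_def split: if_splits)
next
  assume *: "\<forall>a. g6_degree a \<noteq> i \<longrightarrow> x $ a = 0"
  have "x = (\<Sum>a\<in>UNIV. x $ a *s g6_basis a)"
    by (simp add: vec_eq_iff g6_basis_def axis_def if_distrib cong: if_cong)
  also have "\<dots> \<in> g6_part i"
    unfolding g6_part_def
  proof (rule vec.span_sum)
    fix a
    show "x $ a *s g6_basis a \<in> vec.span {g6_basis a |a. g6_degree a = i}"
    proof (cases "g6_degree a = i")
      case True
      then show ?thesis by (intro vec.span_scale vec.span_base) blast
    next
      case False
      with * have "x $ a = 0" by blast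
      then show ?thesis by (simp only: vec.scale_zero_left vec.span_zero)
    qed
  qed
  finally show "x \<in> g6_part i" .
qed

lemma g6_bracket_basis: "g6_bracket \<delta> (g6_basis a) (g6_basis b) = g6_product \<delta> a b"
  by (cases a; cases b; simp add: g6_bracket_def g6_sum_UNIV g6_basis_def axis_def)

lemma g6_bracket_nth:
  "g6_bracket \<delta> x y $ X1 = 0" "g6_bracket \<delta> x y $ X2 = 0"
  "g6_bracket \<delta> x y $ X3 = x $ X1 * y $ X2 - x $ X2 * y $ X1 + \<delta> * (x $ e3 * y $ e3)"
  "g6_bracket \<delta> x y $ e3 = 0"
  "g6_bracket \<delta> x y $ u2 = x $ X1 * y $ e3 - x $ e3 * y $ X1"
  "g6_bracket \<delta> x y $ v2 = x $ X2 * y $ e3 - x $ e3 * y $ X2"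
  by (simp_all add: g6_bracket_def g6_sum_UNIV g6_basis_def axis_def)

lemma lie_superalgebra_g6: "lie_superalgebra (*s) g6_part (g6_bracket \<delta>)"
proof
  fix i show "vec.subspace (g6_part i)" by (simp add: g6_part_def)
next
  show "g6_part 0 \<inter> g6_part 1 = {0}"
    by (auto simp: g6_part_iff vec_eq_iff g6_all)
next
  fix z :: g6
  let ?p = "\<lambda>i. (\<chi> a. if g6_degree a = i then z $ a else 0) :: g6"
  have "?p 0 \<in> g6_part 0" "?p 1 \<in> g6_part 1" "z = ?p 0 + ?p 1"
    by (simp_all add: g6_part_iff vec_eq_iff g6_all)
  then show "\<exists>x\<in>g6_part 0. \<exists>y\<in>g6_part 1. z = x + y"
    by blast
next
  fix i j x y assume "x \<in> g6_part i" "y \<in> g6_part j"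
  then show "g6_bracket \<delta> x y \<in> g6_part (i + j)"
    by (cases i; cases j; simp add: g6_part_iff g6_all g6_bracket_nth)
next
  fix i j x y assume "x \<in> g6_part i" "y \<in> g6_part j"
  then show "g6_bracket \<delta> x y = - (super_sign i j *s g6_bracket \<delta> y x)"
    by (cases i; cases j; simp add: g6_part_iff g6_all g6_bracket_nth super_sign_def vec_eq_iff)
next
  fix i j k x y z assume "x \<in> g6_part i" "y \<in> g6_part j" "z \<in> g6_part k"
  then show "g6_bracket \<delta> x (g6_bracket \<delta> y z) = g6_bracket \<delta> (g6_bracket \<delta> x y) z
      + super_sign i j *s g6_bracket \<delta> y (g6_bracket \<delta> x z)"
    by (cases i; cases j; cases k;
        simp add: g6_part_iff g6_all g6_bracket_nth super_sign_def vec_eq_iff)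
qed (auto simp: vec_eq_iff g6_all g6_bracket_nth algebra_simps)

end

theory Submission
  imports Defs
begin

text \<open>
  Nondegeneracy of an odd form makes each homogeneous component the dual of the other, so both have
  dimension 3 and the flag is \<open>G 1 \<supset> W \<supset> {0}\<close> with \<open>dim W = 2\<close>, where \<open>G 0\<close> maps \<open>G 1\<close> onto \<open>W\<close> and
  kills \<open>W\<close>. Take \<open>e3\<close> in \<open>G 1\<close> outside \<open>W\<close>. Then \<open>W = [G 0, e3]\<close>, so \<open>W\<close> has a basis
  \<open>u2 = [X1, e3]\<close>, \<open>v2 = [X2, e3]\<close>; put \<open>X3 = [X1, X2]\<close>.

  Invariance now determines the form on these six vectors: for instance
  \<open>B(X1, v2) = B([X1, X2], e3) = B(X3, e3) = - B([X2, X1], e3) = - B(X2, u2)\<close>, while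
  \<open>B(X1, u2) = B([X1, X1], e3) = 0\<close> and \<open>B(X3, W) = B(X1, [X2, W]) = 0\<close>
  (\<open>adapted_form\<close>). The common value \<open>\<lambda> = B(X1, v2)\<close> is nonzero, since otherwise \<open>X1\<close> and
  \<open>X2\<close> would both be orthogonal to \<open>W\<close>, and some nontrivial combination of them also to \<open>e3\<close>
  (\<open>adapted_scalar_nonzero\<close>). With \<open>\<lambda> \<noteq> 0\<close> the form allows the coordinates of a vector to be read
  off from its products with the six vectors. Hence these are a basis.

  What remains are the brackets. On \<open>G 1\<close>, \<open>X3\<close> acts as a commutator of maps whose products
  vanish, that is, by zero; on \<open>G 0\<close> it acts by zero because
  \<open>B([X3, X1], z) = B(X3, [X1, z])\<close> lies in \<open>B(X3, W) = 0\<close>, and likewise for \<open>X2\<close>. The odd vector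
  \<open>e3\<close> satisfies \<open>[[e3, e3], e3] = 0\<close>, which forces \<open>[e3, e3]\<close> to be a multiple \<open>a X3\<close>. Letting
  \<open>G 0\<close> act on \<open>[e3, e3]\<close> and then on \<open>[e3, W]\<close> gives \<open>[e3, W] = 0\<close> and \<open>[W, W] = 0\<close>. Finally,
  replacing \<open>e3, u2, v2\<close> by \<open>t e3, t u2, t v2\<close> multiplies \<open>a\<close> by \<open>t\<^sup>2\<close>, and over the complex
  numbers a nonzero \<open>a\<close> becomes 1.

  The computation of the form uses only relations that isomorphisms preserve, so it applies to the image of the
  standard basis under every isomorphism (\<open>iso_adapted\<close>).
\<close>

section \<open>Isomorphisms given by adapted bases\<close>

context lie_superalgebra
begin

lemma br_add_left: "br (x + y) z = br x z + br y z"
  using br_linear_left[of z] by (simp add: Vector_Spaces.linear_iff)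

lemma br_scale_left: "br (scale c x) z = scale c (br x z)"
  using br_linear_left[of z] by (simp add: Vector_Spaces.linear_iff)

lemma br_add_right: "br z (x + y) = br z x + br z y"
  using br_linear_right[of z] by (simp add: Vector_Spaces.linear_iff)

lemma br_scale_right: "br z (scale c x) = scale c (br z x)"
  using br_linear_right[of z] by (simp add: Vector_Spaces.linear_iff)

lemma br_zero_left [simp]: "br 0 z = 0"
  using br_scale_left[of 0 0 z] by simp

lemma br_zero_right [simp]: "br z 0 = 0"
  using br_scale_right[of z 0 0] by simp

lemma br_minus_left: "br (- x) z = - br x z"
  using br_scale_left[of "-1" x z] by simp

lemma br_minus_right: "br z (- x) = - br z x"
  using br_scale_right[of z "-1" x] by simp

lemmas br_bilinear = br_add_left br_scale_left br_add_right br_scale_right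
  br_minus_left br_minus_right

lemma br_sum_left: "br (\<Sum>a\<in>A. f a) z = (\<Sum>a\<in>A. br (f a) z)"
  by (induction A rule: infinite_finite_induct) (simp_all add: br_add_left)

lemma br_sum_right: "br z (\<Sum>a\<in>A. f a) = (\<Sum>a\<in>A. br z (f a))"
  by (induction A rule: infinite_finite_induct) (simp_all add: br_add_right)

lemma G_zero: "0 \<in> G i"
  using subspace_G[of i] by (rule subspace_0)

lemma G_scale: "x \<in> G i \<Longrightarrow> scale c x \<in> G i"
  using subspace_G[of i] by (rule subspace_scale)

lemma G_sumI: "(\<And>a. a \<in> A \<Longrightarrow> f a \<in> G i) \<Longrightarrow> (\<Sum>a\<in>A. f a) \<in> G i"
  using subspace_G[of i] by (rule subspace_sum)

lemma even_skew: "x \<in> G 0 \<Longrightarrow> y \<in> G i \<Longrightarrow> br x y = - br y x"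
  using br_super_skew[of x 0 y i] by (simp add: super_sign_def)

lemma odd_sym: "x \<in> G 1 \<Longrightarrow> y \<in> G 1 \<Longrightarrow> br x y = br y x"
  using br_super_skew[of x 1 y 1] by (simp add: super_sign_def)

lemma even_jacobi:
  "x \<in> G 0 \<Longrightarrow> y \<in> G j \<Longrightarrow> z \<in> G k \<Longrightarrow> br x (br y z) = br (br x y) z + br y (br x z)"
  using br_super_jacobi[of x 0 y j z k] by (simp add: super_sign_def)

lemma even_self: "x \<in> G 0 \<Longrightarrow> br x x = 0"
  using even_skew[of x x 0] scale_eq_0_iff[of 2 "br x x"] scale_left_distrib[of 1 1 "br x x"]
  by (simp add: eq_neg_iff_add_eq_0)

text \<open>The Jacobi identity for three equal odd vectors says that twice a bracket equals minus
  that bracket, so it is characteristic 0 that makes the bracket vanish.\<close>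
lemma odd_cube:
  assumes "x \<in> G 1"
  shows "br (br x x) x = 0"
proof -
  have xx: "br x x \<in> G 0"
    using br_graded[OF assms assms] by simp
  have "br x (br x x) = br (br x x) x - br x (br x x)"
    using br_super_jacobi[OF assms assms assms] by (simp add: super_sign_def)
  moreover have "br x (br x x) = - br (br x x) x"
    using even_skew[OF xx assms] by simp
  ultimately have "scale 3 (br (br x x) x) = 0"
    using scale_left_distrib[of 1 2 "br (br x x) x"] scale_left_distrib[of 1 1 "br (br x x) x"]
    by (simp add: algebra_simps) (metis add.right_inverse)
  then show ?thesis
    by simp
qed

definition combination :: "(g6_index \<Rightarrow> 'a) \<Rightarrow> g6 \<Rightarrow> 'a" where
  "combination b x = (\<Sum>a\<in>UNIV. scale (x $ a) (b a))"

lemma combination_linear: "Vector_Spaces.linear (*s) scale (combination b)"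
  unfolding Vector_Spaces.linear_iff combination_def
  using vec.vector_space_axioms vector_space_axioms
  by (simp add: scale_left_distrib sum.distrib scale_sum_right)

lemma combination_basis: "combination b (g6_basis a) = b a"
  by (cases a) (simp_all add: combination_def g6_sum_UNIV g6_basis_def axis_def)

lemma combination_in_G:
  assumes "\<And>a. b a \<in> G (g6_degree a)" and "x \<in> g6_part i"
  shows "combination b x \<in> G i"
  unfolding combination_def
proof (rule G_sumI)
  fix a
  show "scale (x $ a) (b a) \<in> G i"
    using assms G_scale[of "b a" i "x $ a"] G_zero[of i]
    by (cases "g6_degree a = i") (auto simp: g6_part_iff)
qed

text \<open>A linear map between superalgebras is multiplicative as soon as it is so on a basis.\<close>
lemma combination_iso:
  assumes deg: "\<And>a. b a \<in> G (g6_degree a)"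
    and brackets: "\<And>p q. br (b p) (b q) = combination b (g6_product \<delta> p q)"
    and spans: "\<And>i z. z \<in> G i \<Longrightarrow> \<exists>x\<in>g6_part i. z = combination b x"
    and indep: "\<And>x. combination b x = 0 \<Longrightarrow> x = 0"
  shows "lie_superalgebra_iso (*s) g6_part (g6_bracket \<delta>) scale G br (combination b)"
proof -
  interpret c: Vector_Spaces.linear "(*s)" scale "combination b"
    by (rule combination_linear)
  have "inj (combination b)"
    using c.inj_iff_eq_0 indep by blast
  moreover have "\<exists>x. z = combination b x" for z
    using G_sum[of z] spans c.add by metis
  then have "surj (combination b)"
    by (auto simp: surj_def)
  moreover have "combination b ` g6_part i = G i" for i
    using combination_in_G[OF deg] spans by blast
  moreover have "combination b (g6_bracket \<delta> x y) = br (combination b x) (combination b y)" for x y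
  proof -
    have "combination b (g6_bracket \<delta> x y)
        = (\<Sum>p\<in>UNIV. \<Sum>q\<in>UNIV. scale (x $ p * y $ q) (combination b (g6_product \<delta> p q)))"
      by (simp add: g6_bracket_def c.sum c.scale)
    also have "\<dots> = br (combination b x) (combination b y)"
      by (subst sum.swap)
        (simp add: combination_def[of b x] combination_def[of b y] br_sum_left br_sum_right
          br_bilinear scale_sum_right brackets mult.commute)
    finally show ?thesis .
  qed
  ultimately show ?thesis
    by (simp add: lie_superalgebra_iso_def combination_linear bij_def)
qed

end

section \<open>Duality of the two components\<close>

context odd_quadratic_lie_superalgebra
begin

lemma B_add_left: "B (x + y) z = B x z + B y z"
  using B_linear_left[of z] by (simp add: Vector_Spaces.linear_iff)

lemma B_scale_left: "B (scale c x) z = c * B x z"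
  using B_linear_left[of z] by (simp add: Vector_Spaces.linear_iff)

lemma B_add_right: "B z (x + y) = B z x + B z y"
  using B_linear_right[of z] by (simp add: Vector_Spaces.linear_iff)

lemma B_scale_right: "B z (scale c x) = c * B z x"
  using B_linear_right[of z] by (simp add: Vector_Spaces.linear_iff)

lemma B_zero_left [simp]: "B 0 z = 0"
  using B_scale_left[of 0 0 z] by simp

lemma B_zero_right [simp]: "B z 0 = 0"
  using B_scale_right[of z 0 0] by simp

lemma B_minus_left: "B (- x) z = - B x z"
  using B_scale_left[of "-1" x z] by simp

lemma B_diff_left: "B (x - y) z = B x z - B y z"
  using B_add_left[of x "- y" z] by (simp add: B_minus_left)

lemma B_sum_left: "B (\<Sum>a\<in>A. f a) z = (\<Sum>a\<in>A. B (f a) z)"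
  by (induction A rule: infinite_finite_induct) (simp_all add: B_add_left)

lemmas B_bilinear = B_add_left B_scale_left B_add_right B_scale_right

lemma B_even_odd_sym: "x \<in> G 0 \<Longrightarrow> y \<in> G 1 \<Longrightarrow> B y x = B x y"
  using B_supersymmetric[of y 1 x 0] by (simp add: super_sign_def)

lemma component_nondegenerate:
  assumes "x \<in> G i" and "\<And>y. y \<in> G (i + 1) \<Longrightarrow> B x y = 0"
  shows "x = 0"
proof (rule B_nondegenerate)
  fix y
  obtain p q where "p \<in> G 0" "q \<in> G 1" "y = p + q"
    using G_sum by blast
  then show "B x y = 0"
    using assms B_odd[of x i] by (cases i) (auto simp: B_add_right)
qed

text \<open>Sending \<open>x\<close> to the combination of a basis of the opposite component whose coefficients are
  the products of \<open>x\<close> with this basis embeds one component linearly into the other.\<close>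
lemma component_dim_le:
  assumes "finite_dimensional_vector_space scale E"
  shows "dim (G i) \<le> dim (G (i + 1))"
proof -
  interpret E: finite_dimensional_vector_space scale E
    by (rule assms)
  obtain C where C: "C \<subseteq> G (i + 1)" "independent C" "G (i + 1) \<subseteq> span C"
    by (rule basis_exists[of "G (i + 1)"])
  have fin: "finite C"
    using C(2) by (rule E.finiteI_independent)
  define h where "h x = (\<Sum>c\<in>C. scale (B x c) c)" for x
  have h: "Vector_Spaces.linear scale scale h"
    unfolding Vector_Spaces.linear_iff h_def
    using vector_space_axioms
    by (simp add: B_bilinear scale_left_distrib sum.distrib scale_sum_right)
  have "x = 0" if "x \<in> G i" "h x = 0" for x
  proof (rule component_nondegenerate[OF that(1)])
    fix y assume "y \<in> G (i + 1)"
    then have "y \<in> span C"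
      using C(3) by blast
    moreover have "B x c = 0" if "c \<in> C" for c
      using independentD[OF C(2) fin subset_refl, of "B x" c] that \<open>h x = 0\<close> by (simp add: h_def)
    ultimately show "B x y = 0"
      by (induction rule: span_induct_alt) (simp_all add: B_bilinear)
  qed
  then have "inj_on h (G i)"
    using module_hom.inj_on_iff_eq_0[OF h[folded module_hom_iff_linear] subspace_G] by blast
  moreover have "span (G i) = G i"
    using subspace_G span_eq_iff by blast
  ultimately have "inj_on h (span (G i))"
    by (simp only:)
  then have "dim (h ` G i) = dim (G i)"
    using finite_dimensional_vector_space_pair_1.dim_image_eq[OF
        finite_dimensional_vector_space_pair_1.intro[OF assms vector_space_axioms] h, of "G i"]
    by simp
  moreover have "h ` G i \<subseteq> G (i + 1)"
    using C(1) by (auto simp: h_def intro!: G_sumI G_scale)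
  ultimately show ?thesis
    using E.dim_subset by metis
qed

lemma odd_component_dim:
  assumes "finite_dimensional_vector_space scale E"
  shows "2 * dim (G 1) = dim (UNIV :: 'a set)"
proof -
  interpret E: finite_dimensional_vector_space scale E
    by (rule assms)
  have "{x + y |x y. x \<in> G 0 \<and> y \<in> G 1} = UNIV"
    using G_sum by blast
  then have "dim (UNIV :: 'a set) + dim (G 0 \<inter> G 1) = dim (G 0) + dim (G 1)"
    using E.dim_sums_Int[OF subspace_G subspace_G, of 0 1] by simp
  moreover have "dim (G 0 \<inter> G 1) = 0"
    using G_inter by simp
  moreover have "dim (G 0) = dim (G 1)"
    using component_dim_le[OF assms, of 0] component_dim_le[OF assms, of 1] by simp
  ultimately show ?thesis
    by simp
qed

section \<open>The form is determined by the brackets\<close>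

text \<open>What the choice of \<open>e3, X1, X2\<close> guarantees before the form is used. Through the form these
  conditions imply that the six vectors are a basis, and they fix every bracket other than
  \<open>[e3, e3]\<close>.\<close>
definition adapted :: "(g6_index \<Rightarrow> 'a) \<Rightarrow> bool" where
  "adapted b \<longleftrightarrow> (\<forall>a. b a \<in> G (g6_degree a)) \<and>
     br (b X1) (b X2) = b X3 \<and> br (b X1) (b e3) = b u2 \<and> br (b X2) (b e3) = b v2 \<and>
     (\<forall>p\<in>{X1, X2}. \<forall>q\<in>{u2, v2}. br (b p) (b q) = 0) \<and>
     (\<forall>c d. scale c (b u2) + scale d (b v2) = 0 \<longrightarrow> c = 0 \<and> d = 0) \<and>
     (\<forall>z\<in>G 1. \<exists>c d e. z = scale c (b e3) + scale d (b u2) + scale e (b v2))"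

lemma
  assumes "adapted b"
  shows adapted_degree: "b a \<in> G (g6_degree a)"
    and adapted_even: "b X1 \<in> G 0" "b X2 \<in> G 0" "b X3 \<in> G 0"
    and adapted_odd: "b e3 \<in> G 1" "b u2 \<in> G 1" "b v2 \<in> G 1"
    and adapted_brackets: "br (b X1) (b X2) = b X3" "br (b X1) (b e3) = b u2"
      "br (b X2) (b e3) = b v2" "br (b X1) (b u2) = 0" "br (b X1) (b v2) = 0"
      "br (b X2) (b u2) = 0" "br (b X2) (b v2) = 0"
    and adapted_indep: "scale c (b u2) + scale d (b v2) = 0 \<Longrightarrow> c = 0 \<and> d = 0"
    and adapted_odd_span:
      "z \<in> G 1 \<Longrightarrow> \<exists>c d e. z = scale c (b e3) + scale d (b u2) + scale e (b v2)"
proof -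
  have deg: "b a \<in> G (g6_degree a)" for a
    using assms by (simp add: adapted_def)
  show "b a \<in> G (g6_degree a)"
    by (rule deg)
  show "b X1 \<in> G 0" "b X2 \<in> G 0" "b X3 \<in> G 0" "b e3 \<in> G 1" "b u2 \<in> G 1" "b v2 \<in> G 1"
    using deg[of X1] deg[of X2] deg[of X3] deg[of e3] deg[of u2] deg[of v2] by simp_all
qed (use assms in \<open>simp_all add: adapted_def\<close>)

lemma adapted_form:
  assumes "adapted b"
  shows "B (b p) (b q)
    = g6_form_value (B (b X1) (b v2)) (B (b X1) (b e3)) (B (b X2) (b e3)) p q"
proof -
  note even = adapted_even[OF assms]
  note odd = adapted_odd[OF assms]
  note brackets = adapted_brackets[OF assms]
  have X3_e3: "B (b X3) (b e3) = B (b X1) (b v2)"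
    using B_invariant[of "b X1" "b X2" "b e3"] by (simp add: brackets)
  have X2_u2: "B (b X2) (b u2) = - B (b X1) (b v2)"
    using B_invariant[of "b X2" "b X1" "b e3"] even_skew[OF even(2,1)]
    by (simp add: brackets X3_e3 B_minus_left)
  have diagonal: "B (b X1) (b u2) = 0" "B (b X2) (b v2) = 0"
    using B_invariant[of "b X1" "b X1" "b e3"] B_invariant[of "b X2" "b X2" "b e3"]
    by (simp_all add: brackets even_self even)
  have X3_W: "B (b X3) (b u2) = 0" "B (b X3) (b v2) = 0"
    using B_invariant[of "b X1" "b X2" "b u2"] B_invariant[of "b X1" "b X2" "b v2"]
    by (simp_all add: brackets)
  note sym = B_even_odd_sym[OF even(1)] B_even_odd_sym[OF even(2)] B_even_odd_sym[OF even(3)]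
  show ?thesis
    by (cases p; cases q;
        simp add: B_odd[of _ 0] B_odd[of _ 1] even odd sym X3_e3 X2_u2 diagonal X3_W)
qed

lemma adapted_orthogonal_zero:
  assumes "adapted b" and "x \<in> G 0" "B x (b e3) = 0" "B x (b u2) = 0" "B x (b v2) = 0"
  shows "x = 0"
  by (rule component_nondegenerate[OF assms(2)])
    (use adapted_odd_span[OF assms(1)] assms in \<open>force simp: B_bilinear\<close>)

text \<open>If this value were 0, then the vector \<open>\<beta> X1 - \<alpha> X2\<close>, with \<open>\<alpha> = B(X1, e3)\<close> and
  \<open>\<beta> = B(X2, e3)\<close>, would be orthogonal to everything, hence zero, and bracketing it with \<open>e3\<close>
  would give a linear relation between \<open>u2\<close> and \<open>v2\<close>. So \<open>\<alpha> = \<beta> = 0\<close>, and now \<open>X1\<close> alone is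
  orthogonal to everything.\<close>
lemma adapted_scalar_nonzero:
  assumes "adapted b"
  shows "B (b X1) (b v2) \<noteq> 0"
proof
  assume l: "B (b X1) (b v2) = 0"
  define \<alpha> where "\<alpha> = B (b X1) (b e3)"
  define \<beta> where "\<beta> = B (b X2) (b e3)"
  have form: "B (b p) (b q) = g6_form_value 0 \<alpha> \<beta> p q" for p q
    using adapted_form[OF assms, of p q] by (simp add: l \<alpha>_def \<beta>_def)
  have rel: "c = 0 \<and> d = 0" if "c * \<alpha> + d * \<beta> = 0" for c d
  proof -
    have "scale c (b X1) + scale d (b X2) = 0"
      using that adapted_even[OF assms] subspace_G[of 0]
      by (intro adapted_orthogonal_zero[OF assms])
        (simp_all add: subspace_add subspace_scale B_bilinear form)
    then have "br (scale c (b X1) + scale d (b X2)) (b e3) = 0"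
      by simp
    then show ?thesis
      by (intro adapted_indep[OF assms]) (simp add: br_bilinear adapted_brackets[OF assms])
  qed
  have "\<beta> = 0" "\<alpha> = 0"
    using rel[of \<beta> "- \<alpha>"] by simp_all
  then show False
    using rel[of 1 0] by simp
qed

text \<open>The Gram matrix of the six vectors has nonzero determinant: paired in the order \<open>X3, X2, X1\<close>
  against \<open>e3, u2, v2\<close> it is triangular with diagonal \<open>\<lambda>, -\<lambda>, \<lambda>\<close>.\<close>
lemma adapted_combination_zero:
  assumes b: "adapted b" and x: "combination b x = 0"
  shows "x = 0"
proof -
  have "(\<Sum>p\<in>UNIV. x $ p *
      g6_form_value (B (b X1) (b v2)) (B (b X1) (b e3)) (B (b X2) (b e3)) p q) = 0" for q
    using arg_cong[OF x, of "\<lambda>y. B y (b q)"]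
    by (simp add: combination_def B_sum_left B_bilinear flip: adapted_form[OF b])
  from this[of X1] this[of X2] this[of X3] this[of e3] this[of u2] this[of v2] show ?thesis
    using adapted_scalar_nonzero[OF b] by (simp add: g6_sum_UNIV vec_eq_iff g6_all)
qed

text \<open>An even vector is determined by its products with \<open>e3, u2, v2\<close>; the witness has the
  coefficients that reproduce these products.\<close>
lemma adapted_even_span:
  assumes b: "adapted b" and x: "x \<in> G 0"
  shows "\<exists>c d e. x = scale c (b X1) + scale d (b X2) + scale e (b X3)"
proof -
  define l \<alpha> \<beta> where "l = B (b X1) (b v2)" and "\<alpha> = B (b X1) (b e3)" and "\<beta> = B (b X2) (b e3)"
  have l: "l \<noteq> 0"
    using adapted_scalar_nonzero[OF b] by (simp add: l_def)
  have form: "B (b p) (b q) = g6_form_value l \<alpha> \<beta> p q" for p q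
    unfolding l_def \<alpha>_def \<beta>_def by (rule adapted_form[OF b])
  define c where "c = B x (b v2) / l"
  define d where "d = - B x (b u2) / l"
  define e where "e = (B x (b e3) - c * \<alpha> - d * \<beta>) / l"
  define y where "y = scale c (b X1) + scale d (b X2) + scale e (b X3)"
  have coeffs: "c * l = B x (b v2)" "d * l = - B x (b u2)" "e * l = B x (b e3) - c * \<alpha> - d * \<beta>"
    using l by (simp_all add: c_def d_def e_def)
  have "y \<in> G 0"
    unfolding y_def using adapted_even[OF b] subspace_G[of 0]
    by (simp add: subspace_add subspace_scale)
  then have "x - y \<in> G 0"
    using x subspace_G[of 0] by (simp add: subspace_diff)
  then have "x - y = 0"
    by (rule adapted_orthogonal_zero[OF b])
      (simp_all add: B_diff_left y_def B_bilinear form coeffs)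
  then show ?thesis
    by (auto simp: y_def)
qed

section \<open>The remaining brackets\<close>

lemma double_eq_zero: "x + x = 0 \<Longrightarrow> x = 0" for x :: 'a
  using scale_left_distrib[of 1 1 x] scale_eq_0_iff[of 2 x] by simp

text \<open>On odd vectors this is the Jacobi identity. On even vectors it is a consequence of the form:
  \<open>B([X3, X1], z) = B(X3, [X1, z])\<close>, where \<open>[X1, z]\<close> is a combination of \<open>u2\<close> and \<open>v2\<close>, to which
  \<open>X3\<close> is orthogonal.\<close>
lemma adapted_X3_central:
  assumes b: "adapted b"
  shows "br (b X3) (b a) = 0"
proof -
  note even = adapted_even[OF b]
  note odd = adapted_odd[OF b]
  note brackets = adapted_brackets[OF b]
  have "br (b X3) (b a) = 0" if "a \<in> {e3, u2, v2}"
    using that even_jacobi[OF even(1,2) odd(1)] even_jacobi[OF even(1,2) odd(2)]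
      even_jacobi[OF even(1,2) odd(3)]
    by (auto simp: brackets)
  moreover have "br (b X3) (b a) = 0" if "a \<in> {X1, X2}"
    by (rule adapted_orthogonal_zero[OF b])
      (use that br_graded[OF even(3) even(1)] br_graded[OF even(3) even(2)] in
        \<open>auto simp: B_invariant brackets adapted_form[OF b, of X3]\<close>)
  moreover have "br (b X3) (b X3) = 0"
    using even by (intro even_self)
  ultimately show ?thesis
    by (cases a) simp_all
qed

text \<open>The cube of \<open>e3\<close> vanishes, and bracketing with \<open>e3\<close> sees exactly the \<open>X1\<close> and \<open>X2\<close>
  coefficients of \<open>[e3, e3]\<close>.\<close>
lemma adapted_odd_square:
  assumes b: "adapted b"
  shows "\<exists>a. br (b e3) (b e3) = scale a (b X3)"
proof -
  note odd = adapted_odd[OF b]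
  have "br (b e3) (b e3) \<in> G 0"
    using br_graded[OF odd(1) odd(1)] by simp
  then obtain c d a
    where cda: "br (b e3) (b e3) = scale c (b X1) + scale d (b X2) + scale a (b X3)"
    using adapted_even_span[OF b] by blast
  have "scale c (b u2) + scale d (b v2) = br (br (b e3) (b e3)) (b e3)"
    unfolding cda by (simp add: br_bilinear adapted_brackets[OF b] adapted_X3_central[OF b])
  then have "c = 0 \<and> d = 0"
    by (intro adapted_indep[OF b]) (simp add: odd_cube odd)
  then show ?thesis
    using cda by auto
qed

text \<open>\<open>[e3, e3]\<close> is central in the even part, so acting on it by \<open>X1\<close> and \<open>X2\<close> gives
  \<open>2 [u2, e3] = 0\<close> and \<open>2 [v2, e3] = 0\<close>; acting on these products by \<open>X1\<close> and \<open>X2\<close> again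
  gives the rest.\<close>
lemma adapted_odd_products:
  assumes b: "adapted b" and p: "p \<in> {e3, u2, v2}" and q: "q \<in> {u2, v2}"
  shows "br (b p) (b q) = 0" "br (b q) (b p) = 0"
proof -
  note even = adapted_even[OF b]
  note odd = adapted_odd[OF b]
  note brackets = adapted_brackets[OF b]
  obtain a where a: "br (b e3) (b e3) = scale a (b X3)"
    using adapted_odd_square[OF b] by blast
  have "br (b X1) (b X3) = 0" "br (b X2) (b X3) = 0"
    using even_skew[OF even(1,3)] even_skew[OF even(2,3)] adapted_X3_central[OF b] by simp_all
  then have "br (b e3) (b u2) + br (b e3) (b u2) = 0" "br (b e3) (b v2) + br (b e3) (b v2) = 0"
    using even_jacobi[OF even(1) odd(1) odd(1)] even_jacobi[OF even(2) odd(1) odd(1)]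
      odd_sym[OF odd(2,1)] odd_sym[OF odd(3,1)]
    by (simp_all add: a br_scale_right brackets)
  then have e3_W: "br (b e3) (b u2) = 0" "br (b e3) (b v2) = 0"
    by (auto dest: double_eq_zero)
  have W_W: "br (b u2) (b u2) = 0" "br (b u2) (b v2) = 0" "br (b v2) (b v2) = 0"
    using even_jacobi[OF even(1) odd(1) odd(2)] even_jacobi[OF even(1) odd(1) odd(3)]
      even_jacobi[OF even(2) odd(1) odd(3)]
    by (simp_all add: e3_W brackets)
  show "br (b p) (b q) = 0" "br (b q) (b p) = 0"
    using p q e3_W W_W odd_sym[OF odd(2,1)] odd_sym[OF odd(3,1)] odd_sym[OF odd(3,2)] by auto
qed

lemma adapted_iso:
  assumes b: "adapted b" and square: "br (b e3) (b e3) = scale \<delta> (b X3)"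
  shows "lie_superalgebra_iso (*s) g6_part (g6_bracket \<delta>) scale G br (combination b)"
proof (rule combination_iso)
  interpret c: Vector_Spaces.linear "(*s)" scale "combination b"
    by (rule combination_linear)
  note even = adapted_even[OF b]
  note brackets = adapted_brackets[OF b]
  have X3: "br (b a) (b X3) = 0" for a
    using even_skew[OF even(3) adapted_degree[OF b, of a]] adapted_X3_central[OF b, of a] by simp
  show "br (b p) (b q) = combination b (g6_product \<delta> p q)" for p q
  proof -
    have rev: "br (b a) (b c) = - br (b c) (b a)" if "c \<in> {X1, X2}" for a c
      using even_skew[of "b c" "b a" "g6_degree a"] even adapted_degree[OF b, of a] that by auto
    show ?thesis
      by (cases p; cases q;
          simp add: c.scale c.neg c.zero combination_basis brackets X3 adapted_X3_central[OF b]
            adapted_odd_products[OF b] square even_self even rev[of X1 X2] rev[of X1 e3]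
            rev[of X2 e3] rev[of X1 u2] rev[of X2 u2] rev[of X1 v2] rev[of X2 v2])
  qed
  show "\<exists>x\<in>g6_part i. z = combination b x" if z: "z \<in> G i" for i z
  proof (cases "i = 0")
    case True
    then obtain c d e where "z = scale c (b X1) + scale d (b X2) + scale e (b X3)"
      using adapted_even_span[OF b, of z] z by auto
    then show ?thesis
      using True by (intro bexI[of _ "\<chi> a. case a of X1 \<Rightarrow> c | X2 \<Rightarrow> d | X3 \<Rightarrow> e | _ \<Rightarrow> 0"])
        (simp_all add: combination_def g6_sum_UNIV g6_part_iff g6_all)
  next
    case False
    then have i: "i = 1"
      by (cases i) simp_all
    then obtain c d e where "z = scale c (b e3) + scale d (b u2) + scale e (b v2)"
      using adapted_odd_span[OF b, of z] z by auto
    then show ?thesis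
      using i by (intro bexI[of _ "\<chi> a. case a of e3 \<Rightarrow> c | u2 \<Rightarrow> d | v2 \<Rightarrow> e | _ \<Rightarrow> 0"])
        (simp_all add: combination_def g6_sum_UNIV g6_part_iff g6_all)
  qed
qed (use adapted_degree[OF b] adapted_combination_zero[OF b] in blast)+

lemma adapted_rescale:
  assumes b: "adapted b" and t: "t \<noteq> 0"
  shows "adapted (\<lambda>a. if g6_degree a = 1 then scale t (b a) else b a)" (is "adapted ?b")
proof -
  have "?b a \<in> G (g6_degree a)" for a
    using adapted_degree[OF b, of a] by (cases a) (simp_all add: G_scale)
  moreover have "c = 0 \<and> d = 0" if "scale c (scale t (b u2)) + scale d (scale t (b v2)) = 0" for c d
    using adapted_indep[OF b, of "c * t" "d * t"] that t by simp
  moreover have "\<exists>c d e. z = scale c (scale t (b e3)) + scale d (scale t (b u2))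
      + scale e (scale t (b v2))" if z: "z \<in> G 1" for z
  proof -
    obtain c d e where "z = scale c (b e3) + scale d (b u2) + scale e (b v2)"
      using adapted_odd_span[OF b z] by blast
    then show ?thesis
      using t by (intro exI[of _ "c / t"] exI[of _ "d / t"] exI[of _ "e / t"]) simp
  qed
  ultimately show ?thesis
    unfolding adapted_def by (simp add: adapted_brackets[OF b] br_bilinear)
qed

lemma adapted_normalize:
  assumes b: "adapted b"
  shows "\<exists>\<delta>\<in>{0, 1}. \<exists>\<phi>. lie_superalgebra_iso (*s) g6_part (g6_bracket \<delta>) scale G br \<phi>"
proof -
  obtain a where a: "br (b e3) (b e3) = scale a (b X3)"
    using adapted_odd_square[OF b] by blast
  show ?thesis
  proof (cases "a = 0")
    case True
    then show ?thesis
      using adapted_iso[OF b] a by blast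
  next
    case False
    define t where "t = 1 / csqrt a"
    have t: "t \<noteq> 0" "t * (t * a) = 1"
      using False power2_csqrt[of a] by (simp_all add: t_def field_simps power2_eq_square)
    have "adapted (\<lambda>a. if g6_degree a = 1 then scale t (b a) else b a)" (is "adapted ?b")
      by (rule adapted_rescale[OF b t(1)])
    moreover have "br (?b e3) (?b e3) = scale 1 (?b X3)"
      using t(2) by (simp add: br_bilinear a)
    ultimately show ?thesis
      using adapted_iso by blast
  qed
qed

lemma iso_adapted:
  assumes "lie_superalgebra_iso (*s) g6_part (g6_bracket \<delta>) scale G br \<phi>"
  shows "adapted (\<lambda>a. \<phi> (g6_basis a))"
proof -
  interpret \<phi>: Vector_Spaces.linear "(*s)" scale \<phi>
    using assms by (simp add: lie_superalgebra_iso_def)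
  have inj: "inj \<phi>" and image: "\<phi> ` g6_part i = G i"
    and hom: "br (\<phi> x) (\<phi> y) = \<phi> (g6_bracket \<delta> x y)" for i x y
    using assms by (auto simp: lie_superalgebra_iso_def bij_def)
  have "\<phi> (g6_basis a) \<in> G (g6_degree a)" for a
    unfolding image[symmetric] by (auto simp: g6_part_iff g6_basis_def axis_def)
  moreover have "c = 0 \<and> d = 0"
    if "scale c (\<phi> (g6_basis u2)) + scale d (\<phi> (g6_basis v2)) = 0" for c d
  proof -
    have "\<phi> (c *s g6_basis u2 + d *s g6_basis v2) = 0"
      using that by (simp add: \<phi>.add \<phi>.scale)
    then have "c *s g6_basis u2 + d *s g6_basis v2 = 0"
      using inj \<phi>.inj_iff_eq_0 by blast
    then show ?thesis
      by (simp add: vec_eq_iff g6_all g6_basis_def axis_def)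
  qed
  moreover have "\<exists>c d e. z = scale c (\<phi> (g6_basis e3)) + scale d (\<phi> (g6_basis u2))
      + scale e (\<phi> (g6_basis v2))" if "z \<in> G 1" for z
  proof -
    obtain x where x: "x \<in> g6_part 1" "z = \<phi> x"
      using \<open>z \<in> G 1\<close> image by blast
    then have "x = x $ e3 *s g6_basis e3 + x $ u2 *s g6_basis u2 + x $ v2 *s g6_basis v2"
      by (simp add: g6_part_iff vec_eq_iff g6_all g6_basis_def axis_def)
    then have "z = scale (x $ e3) (\<phi> (g6_basis e3)) + scale (x $ u2) (\<phi> (g6_basis u2))
        + scale (x $ v2) (\<phi> (g6_basis v2))"
      using x(2) by (metis \<phi>.add \<phi>.scale)
    then show ?thesis
      by blast
  qed
  ultimately show ?thesis
    unfolding adapted_def by (simp add: hom g6_bracket_basis \<phi>.zero)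
qed

section \<open>Weak filiform algebras with a three-dimensional odd part\<close>

text \<open>The content of the flag for \<open>dim (G 1) = 3\<close>: the even part acts on \<open>G 1\<close> through \<open>e\<close> alone,
  with image spanned by \<open>[x1, e]\<close> and \<open>[x2, e]\<close>, on which the action is trivial.\<close>
lemma weak_filiform_generators:
  assumes "finite_dimensional_vector_space scale E"
    and "weak_filiform" and dim3: "dim (G 1) = 3"
  obtains e x1 x2 where "e \<in> G 1" "x1 \<in> G 0" "x2 \<in> G 0"
    "\<And>c d. scale c (br x1 e) + scale d (br x2 e) = 0 \<Longrightarrow> c = 0 \<and> d = 0"
    "\<And>z. z \<in> G 1 \<Longrightarrow> \<exists>c d f. z = scale c e + scale d (br x1 e) + scale f (br x2 e)"
    "\<And>x y. x \<in> G 0 \<Longrightarrow> y \<in> G 0 \<Longrightarrow> br x (br y e) = 0"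
proof -
  interpret E: finite_dimensional_vector_space scale E
    by (rule assms)
  obtain V where V: "V 3 = G 1" "V 1 = {0}"
    and flag: "\<forall>i\<in>{2..3}. subspace (V i) \<and> dim (V i) = i \<and> V (i - 1) \<subset> V i \<and>
        span {br x v |x v. x \<in> G 0 \<and> v \<in> V i} = V (i - 1)"
    using assms(2) unfolding weak_filiform_def dim3 by blast
  define W where "W = V 2"
  have W: "subspace W" "dim W = 2" "W \<subset> G 1"
    and span1: "span {br x v |x v. x \<in> G 0 \<and> v \<in> G 1} = W"
    and span2: "span {br x v |x v. x \<in> G 0 \<and> v \<in> W} = {0}"
    using flag[rule_format, of 2] flag[rule_format, of 3] V by (simp_all add: W_def)
  have act: "br x v \<in> W" if "x \<in> G 0" "v \<in> G 1" for x v
    unfolding span1[symmetric] using that by (intro span_base) blast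
  have kill: "br x v = 0" if "x \<in> G 0" "v \<in> W" for x v
  proof -
    have "br x v \<in> span {br x v |x v. x \<in> G 0 \<and> v \<in> W}"
      using that by (intro span_base) blast
    then show ?thesis
      by (simp add: span2)
  qed
  obtain e where e: "e \<in> G 1" "e \<notin> W"
    using W(3) by blast
  have spanW: "span W = W"
    using W(1) by simp
  have "dim (insert e W) = 3"
    using e W(2) by (simp add: E.dim_insert spanW)
  then have "G 1 \<subseteq> span (insert e W)"
    using E.subspace_dim_equal[of "span (insert e W)" "G 1"] subspace_G[of 1] e W(3) dim3
    by (simp add: span_minimal psubset_imp_subset)
  then have G1: "\<exists>c. z - scale c e \<in> W" if "z \<in> G 1" for z
    using that by (auto simp: span_breakdown_eq spanW)
  \<comment> \<open>\<open>[x, c e + w] = [c x, e]\<close> for \<open>w\<close> in \<open>W\<close>, so the brackets already form a subspace.\<close>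
  have image: "W = (\<lambda>x. br x e) ` G 0"
  proof
    have "{br x v |x v. x \<in> G 0 \<and> v \<in> G 1} \<subseteq> (\<lambda>x. br x e) ` G 0"
    proof clarify
      fix x v assume x: "x \<in> G 0" and "v \<in> G 1"
      then obtain c where c: "v - scale c e \<in> W"
        using G1 by blast
      have "br x v = br x (scale c e + (v - scale c e))"
        by simp
      also have "\<dots> = br (scale c x) e"
        using kill[OF x c] by (simp only: br_bilinear add_0_right)
      finally show "br x v \<in> (\<lambda>x. br x e) ` G 0"
        using G_scale[OF x] by blast
    qed
    moreover have "subspace ((\<lambda>x. br x e) ` G 0)"
      by (rule module_hom.subspace_image)
         (use br_linear_left[of e] subspace_G in \<open>simp_all add: module_hom_iff_linear\<close>)
    ultimately show "W \<subseteq> (\<lambda>x. br x e) ` G 0"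
      using span1 span_minimal by blast
    show "(\<lambda>x. br x e) ` G 0 \<subseteq> W"
      using act e(1) by blast
  qed
  obtain C where C: "C \<subseteq> W" "independent C" "W \<subseteq> span C" "card C = 2"
    using basis_exists[of W] W(2) by metis
  obtain u v where uv: "C = {u, v}" "u \<noteq> v"
    using C(4) by (meson card_2_iff)
  obtain x1 x2 where x: "x1 \<in> G 0" "u = br x1 e" "x2 \<in> G 0" "v = br x2 e"
    using C(1) image uv by auto
  show thesis
  proof (rule that[OF e(1) x(1,3), folded x(2,4)])
    fix c d assume *: "scale c u + scale d v = 0"
    show "c = 0 \<and> d = 0"
      using independentD[OF C(2), of C "\<lambda>w. if w = u then c else d" u]
        independentD[OF C(2), of C "\<lambda>w. if w = u then c else d" v] uv *
      by simp
  next
    fix z assume "z \<in> G 1"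
    then obtain c where c: "z - scale c e \<in> span {u, v}"
      using G1 C(3) uv by blast
    then obtain d where "z - scale c e - scale d u \<in> span {v}"
      by (auto simp: span_breakdown_eq)
    then obtain f where "z - scale c e - scale d u = scale f v"
      by (auto simp: span_singleton)
    then have "z = scale c e + scale d u + scale f v"
      by (simp add: algebra_simps)
    then show "\<exists>c d f. z = scale c e + scale d u + scale f v"
      by blast
  next
    fix x y assume "x \<in> G 0" "y \<in> G 0"
    then show "br x (br y e) = 0"
      using kill act e(1) by blast
  qed
qed

lemma weak_filiform_adapted:
  assumes "dim (UNIV :: 'a set) = 6" and "weak_filiform"
  shows "\<exists>b. adapted b"
proof -
  obtain E :: "'a set" where E: "independent E" "UNIV \<subseteq> span E" "card E = 6"
    using basis_exists[of UNIV] assms(1) by metis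
  have "finite E"
    using E(3) card.infinite by fastforce
  then have fin: "finite_dimensional_vector_space scale E"
    using E by unfold_locales auto
  have "dim (G 1) = 3"
    using odd_component_dim[OF fin] assms(1) by simp
  then obtain e x1 x2 where gen: "e \<in> G 1" "x1 \<in> G 0" "x2 \<in> G 0"
    and indep: "\<And>c d. scale c (br x1 e) + scale d (br x2 e) = 0 \<Longrightarrow> c = 0 \<and> d = 0"
    and spans: "\<And>z. z \<in> G 1 \<Longrightarrow> \<exists>c d f. z = scale c e + scale d (br x1 e) + scale f (br x2 e)"
    and kill: "\<And>x y. x \<in> G 0 \<Longrightarrow> y \<in> G 0 \<Longrightarrow> br x (br y e) = 0"
    using weak_filiform_generators[OF fin assms(2)] by metis
  define b where "b a = (case a of X1 \<Rightarrow> x1 | X2 \<Rightarrow> x2 | X3 \<Rightarrow> br x1 x2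
    | e3 \<Rightarrow> e | u2 \<Rightarrow> br x1 e | v2 \<Rightarrow> br x2 e)" for a
  have "b a \<in> G (g6_degree a)" for a
    using gen br_graded[of x1 0 x2 0] br_graded[of x1 0 e 1] br_graded[of x2 0 e 1]
    by (cases a) (simp_all add: b_def)
  moreover have "\<forall>c d. scale c (b u2) + scale d (b v2) = 0 \<longrightarrow> c = 0 \<and> d = 0"
    using indep by (simp add: b_def)
  moreover have "\<forall>z\<in>G 1. \<exists>c d f. z = scale c (b e3) + scale d (b u2) + scale f (b v2)"
    using spans by (simp add: b_def)
  moreover have "\<forall>p\<in>{X1, X2}. \<forall>q\<in>{u2, v2}. br (b p) (b q) = 0"
    using kill gen by (simp add: b_def)
  ultimately have "adapted b"
    unfolding adapted_def by (simp add: b_def)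
  then show ?thesis
    by blast
qed

end

theorem theorem4p2:
  fixes s :: "complex \<Rightarrow> 'a::ab_group_add \<Rightarrow> 'a"
    and G :: "bit \<Rightarrow> 'a set"
    and br :: "'a \<Rightarrow> 'a \<Rightarrow> 'a"
    and B :: "'a \<Rightarrow> 'a \<Rightarrow> complex"
  assumes "odd_quadratic_lie_superalgebra s G br B"
    and "vector_space.dim s (UNIV :: 'a set) = 6"
    and "lie_superalgebra.weak_filiform s G br"
  shows "(\<exists>\<delta>\<in>{0, 1}. \<exists>\<phi>. lie_superalgebra_iso (*s) g6_part (g6_bracket \<delta>) s G br \<phi>) \<and>
    (\<forall>\<delta>\<in>{0, 1}. \<forall>\<phi>. lie_superalgebra_iso (*s) g6_part (g6_bracket \<delta>) s G br \<phi> \<longrightarrow>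
      (\<exists>l \<alpha> \<beta>. l \<noteq> 0 \<and>
        (\<forall>a b. B (\<phi> (g6_basis a)) (\<phi> (g6_basis b)) = g6_form_value l \<alpha> \<beta> a b)))"
proof -
  interpret odd_quadratic_lie_superalgebra s G br B
    by (rule assms)
  obtain b where "adapted b"
    using weak_filiform_adapted[OF assms(2,3)] by blast
  then have "\<exists>\<delta>\<in>{0, 1}. \<exists>\<phi>. lie_superalgebra_iso (*s) g6_part (g6_bracket \<delta>) s G br \<phi>"
    by (rule adapted_normalize)
  moreover have "\<exists>l \<alpha> \<beta>. l \<noteq> 0 \<and>
      (\<forall>a b. B (\<phi> (g6_basis a)) (\<phi> (g6_basis b)) = g6_form_value l \<alpha> \<beta> a b)"
    if "lie_superalgebra_iso (*s) g6_part (g6_bracket \<delta>) s G br \<phi>" for \<delta> \<phi>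
    using adapted_form[OF iso_adapted[OF that]] adapted_scalar_nonzero[OF iso_adapted[OF that]]
    by blast
  ultimately show ?thesis
    by blast
qed

end
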